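(* Let $S$ be a semiring. The $S$-semialgebra $S[[X]]$ is a McCoy $S$-semialgebra (that is, for all $f,g\in S[[X]]$ with $fg=0$ and $g\neq 0$ there is a nonzero $s\in S$ with $sA_f=(0)$) if one of the following conditions holds: (1) the semiring $S$ is nilpotent-free and weak Gaussian; (2) the semiring $S$ is zerosumfree.
   Context: A semiring is a set $S$ with operations $+,\cdot$ such that $(S,+,0)$ and $(S,\cdot,1)$ are commutative monoids with $1\neq 0$, multiplication distributes over addition, and $s\cdot 0=0$ for all $s$. An ideal of $S$ is a nonempty subset closed under addition and under multiplication by elements of $S$. A proper ideal $\mathfrak p$ is prime if $ab\in\mathfrak p$ implies $a\in\mathfrak p$ or $b\in\mathfrak p$. An ideal $I$ is subtractive if $a+b\in I$ and $a\in I$ imply $b\in I$. $S$ is weak Gaussian if every prime ideal of $S$ is subtractive; nilpotent-free if $s^2=0$ implies $s=0$ for all $s\in S$; zerosumfree if $a+b=0$ implies $a=b=0$ for all $a,b\in S$. $S[[X]]$ is the semiring of formal power series over $S$; for $f\in S[[X]]$, $A_f$ is the ideal of $S$ generated by all coefficients of $f$. *)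

theory Defs
  imports "HOL-Computational_Algebra.Formal_Power_Series"
begin

text \<open>
  A (commutative) semiring with \<open>1 \<noteq> 0\<close> is a type of class \<open>comm_semiring_1\<close>; properties
  of the semiring as a whole take the type as an argument of type \<open>'a itself\<close>.
\<close>

definition semiring_ideal :: "'a::comm_semiring_1 set \<Rightarrow> bool" where
  "semiring_ideal I \<longleftrightarrow>
     I \<noteq> {} \<and> (\<forall>a\<in>I. \<forall>b\<in>I. a + b \<in> I) \<and> (\<forall>s. \<forall>a\<in>I. s * a \<in> I)"

definition semiring_prime_ideal :: "'a::comm_semiring_1 set \<Rightarrow> bool" where
  "semiring_prime_ideal P \<longleftrightarrow>
     semiring_ideal P \<and> P \<noteq> UNIV \<and> (\<forall>a b. a * b \<in> P \<longrightarrow> a \<in> P \<or> b \<in> P)"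

definition subtractive :: "'a::comm_semiring_1 set \<Rightarrow> bool" where
  "subtractive I \<longleftrightarrow> (\<forall>a b. a + b \<in> I \<and> a \<in> I \<longrightarrow> b \<in> I)"

definition weak_Gaussian :: "'a::comm_semiring_1 itself \<Rightarrow> bool" where
  "weak_Gaussian TYPE('a) \<longleftrightarrow> (\<forall>P::'a set. semiring_prime_ideal P \<longrightarrow> subtractive P)"

definition nilpotent_free :: "'a::comm_semiring_1 itself \<Rightarrow> bool" where
  "nilpotent_free TYPE('a) \<longleftrightarrow> (\<forall>s::'a. s ^ 2 = 0 \<longrightarrow> s = 0)"

definition zerosumfree :: "'a::comm_semiring_1 itself \<Rightarrow> bool" where
  "zerosumfree TYPE('a) \<longleftrightarrow> (\<forall>a b::'a. a + b = 0 \<longrightarrow> a = 0 \<and> b = 0)"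

definition ideal_generated :: "'a::comm_semiring_1 set \<Rightarrow> 'a set" where
  "ideal_generated X = \<Inter>{I. semiring_ideal I \<and> X \<subseteq> I}"

definition coeff_ideal :: "'a::comm_semiring_1 fps \<Rightarrow> 'a set" where
  "coeff_ideal f = ideal_generated (range (fps_nth f))"

definition McCoy_fps :: "'a::comm_semiring_1 itself \<Rightarrow> bool" where
  "McCoy_fps TYPE('a) \<longleftrightarrow>
     (\<forall>f g::'a fps. f * g = 0 \<and> g \<noteq> 0 \<longrightarrow>
        (\<exists>s. s \<noteq> 0 \<and> (\<lambda>a. s * a) ` coeff_ideal f = {0}))"

end

theory Submission
  imports Defs
begin

text \<open>
  In both cases \<open>f * g = 0\<close> forces every product \<open>f\<^sub>i g\<^sub>j\<close> to vanish, so any nonzero coefficient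
  of \<open>g\<close> annihilates \<open>A\<^sub>f\<close>. If the semiring is zerosumfree this is immediate. Otherwise let \<open>P\<close> be
  a prime ideal and suppose that \<open>f\<close> and \<open>g\<close> both have coefficients outside \<open>P\<close>; for the first
  such \<open>f\<^sub>m\<close> and \<open>g\<^sub>n\<close>, all other summands of the coefficient \<open>0\<close> of \<open>f * g\<close> at \<open>m + n\<close> lie in \<open>P\<close>,
  so subtractivity gives \<open>f\<^sub>m g\<^sub>n \<in> P\<close>, a contradiction. Hence \<open>f\<^sub>i g\<^sub>j\<close> lies in every prime ideal,
  and in a nilpotent-free semiring the intersection of the prime ideals is zero (Krull).
\<close>

lemma semiring_idealI:
  assumes "0 \<in> I" "\<And>a b. a \<in> I \<Longrightarrow> b \<in> I \<Longrightarrow> a + b \<in> I" "\<And>s a. a \<in> I \<Longrightarrow> s * a \<in> I"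
  shows "semiring_ideal I"
  using assms unfolding semiring_ideal_def by blast

lemma semiring_ideal_add: "semiring_ideal I \<Longrightarrow> a \<in> I \<Longrightarrow> b \<in> I \<Longrightarrow> a + b \<in> I"
  unfolding semiring_ideal_def by blast

lemma semiring_ideal_mult: "semiring_ideal I \<Longrightarrow> a \<in> I \<Longrightarrow> s * a \<in> I"
  unfolding semiring_ideal_def by blast

lemma semiring_ideal_mult_right: "semiring_ideal I \<Longrightarrow> a \<in> I \<Longrightarrow> a * s \<in> I"
  using semiring_ideal_mult[of I a s] by (simp add: mult.commute)

lemma semiring_ideal_zero:
  assumes "semiring_ideal I"
  shows "0 \<in> I"
proof -
  obtain a where "a \<in> I"
    using assms unfolding semiring_ideal_def by blast
  then have "0 * a \<in> I"
    using assms by (rule semiring_ideal_mult[rotated])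
  then show ?thesis by simp
qed

lemma semiring_ideal_sum:
  assumes "semiring_ideal I" "\<And>k. k \<in> A \<Longrightarrow> h k \<in> I"
  shows "sum h A \<in> I"
  using assms(2)
  by (induction A rule: infinite_finite_induct)
    (auto simp: semiring_ideal_zero[OF assms(1)] intro: semiring_ideal_add[OF assms(1)])

text \<open>Provides the upper bounds for Zorn's lemma. Any two members of the chain are comparable,
  so two elements of the union already lie in a common ideal.\<close>

lemma semiring_ideal_Union_chain:
  assumes "subset.chain {I. semiring_ideal I} C" "C \<noteq> {}"
  shows "semiring_ideal (\<Union>C)"
proof (rule semiring_idealI)
  have ideals: "semiring_ideal I" if "I \<in> C" for I
    using assms(1) that by (auto simp: subset_chain_def)
  show "0 \<in> \<Union>C"
    using assms(2) ideals semiring_ideal_zero by blast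
  show "a + b \<in> \<Union>C" if "a \<in> \<Union>C" "b \<in> \<Union>C" for a b
  proof -
    from that obtain I J where "I \<in> C" "a \<in> I" "J \<in> C" "b \<in> J" by blast
    moreover from this have "I \<subseteq> J \<or> J \<subseteq> I"
      using assms(1) by (auto simp: subset_chain_def)
    ultimately show ?thesis
      using ideals semiring_ideal_add by (metis UnionI subsetD)
  qed
  show "s * a \<in> \<Union>C" if "a \<in> \<Union>C" for s a
    using that ideals semiring_ideal_mult by blast
qed

text \<open>This is the ideal generated by \<open>P\<close> and \<open>x\<close>, used below to test
  the maximality of \<open>P\<close>.\<close>

lemma semiring_ideal_adjoin:
  assumes "semiring_ideal P"
  shows "semiring_ideal {p + r * x | p r. p \<in> P}"
proof (rule semiring_idealI)
  have "0 = 0 + 0 * x" by simp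
  then show "0 \<in> {p + r * x | p r. p \<in> P}"
    using semiring_ideal_zero[OF assms] by blast
next
  fix a b assume "a \<in> {p + r * x | p r. p \<in> P}" "b \<in> {p + r * x | p r. p \<in> P}"
  then obtain p r q t where "a = p + r * x" "b = q + t * x" "p \<in> P" "q \<in> P" by blast
  moreover from this have "a + b = (p + q) + (r + t) * x" by (simp add: algebra_simps)
  ultimately show "a + b \<in> {p + r * x | p r. p \<in> P}"
    using semiring_ideal_add[OF assms] by blast
next
  fix s a assume "a \<in> {p + r * x | p r. p \<in> P}"
  then obtain p r where "a = p + r * x" "p \<in> P" by blast
  moreover from this have "s * a = s * p + (s * r) * x" by (simp add: algebra_simps)
  ultimately show "s * a \<in> {p + r * x | p r. p \<in> P}"
    using semiring_ideal_mult[OF assms] by blast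
qed

text \<open>Krull's argument: by Zorn's lemma there is an ideal maximal among those containing no
  power of \<open>a\<close>, and maximality makes it prime.\<close>

lemma prime_ideal_avoiding_powers:
  fixes a :: "'a::comm_semiring_1"
  assumes "\<And>n. a ^ n \<noteq> 0"
  obtains P where "semiring_prime_ideal P" "a \<notin> P"
proof -
  define F where "F = {I. semiring_ideal I \<and> (\<forall>n. a ^ n \<notin> I)}"
  have "semiring_ideal {0::'a}"
    by (rule semiring_idealI) auto
  then have "{0} \<in> F"
    using assms by (auto simp: F_def)
  moreover have "\<Union>C \<in> F" if "C \<noteq> {}" "subset.chain F C" for C
  proof -
    have "subset.chain {I. semiring_ideal I} C"
      using that(2) by (auto simp: subset_chain_def F_def)
    then have "semiring_ideal (\<Union>C)"
      using that(1) by (rule semiring_ideal_Union_chain)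
    then show ?thesis
      using that(2) by (auto simp: subset_chain_def F_def)
  qed
  ultimately obtain P where "P \<in> F" and maximal: "\<And>I. I \<in> F \<Longrightarrow> P \<subseteq> I \<Longrightarrow> I = P"
    using subset_Zorn_nonempty[of F] by blast
  then have ideal: "semiring_ideal P" and avoids: "\<And>n. a ^ n \<notin> P"
    by (auto simp: F_def)
  \<comment> \<open>Adjoining \<open>x\<close> to \<open>P\<close> gives a strictly larger ideal,
    which by maximality must contain a power of \<open>a\<close>.\<close>
  have power_in_adjoin: "\<exists>n p r. p \<in> P \<and> a ^ n = p + r * x" if "x \<notin> P" for x
  proof -
    let ?I = "{p + r * x | p r. p \<in> P}"
    have "p = p + 0 * x" for p by simp
    then have "P \<subseteq> ?I" by blast
    moreover have "x = 0 + 1 * x" by simp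
    then have "x \<in> ?I" using semiring_ideal_zero[OF ideal] by blast
    ultimately have "?I \<notin> F" using maximal that by blast
    then show ?thesis
      using semiring_ideal_adjoin[OF ideal, of x] unfolding F_def by blast
  qed
  have "x \<in> P \<or> y \<in> P" if "x * y \<in> P" for x y
  proof (rule ccontr)
    assume "\<not> (x \<in> P \<or> y \<in> P)"
    then obtain m p r n q t where eqs: "a ^ m = p + r * x" "a ^ n = q + t * y"
      and "p \<in> P" "q \<in> P"
      using power_in_adjoin by metis
    \<comment> \<open>The product is grouped so that each summand has a factor \<open>p\<close>,
      \<open>q\<close> or \<open>x * y\<close>, all of them in \<open>P\<close>.\<close>
    have "a ^ (m + n) = p * (q + t * y) + ((r * x) * q + (r * t) * (x * y))"
      by (simp add: power_add eqs algebra_simps)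
    also have "\<dots> \<in> P"
      using ideal that \<open>p \<in> P\<close> \<open>q \<in> P\<close>
      by (intro semiring_ideal_add semiring_ideal_mult_right[of P p]
          semiring_ideal_mult[of P q] semiring_ideal_mult[of P "x * y"])
    finally show False using avoids by blast
  qed
  moreover have "P \<noteq> UNIV" "a \<notin> P"
    using avoids avoids[of 1] by auto
  ultimately show ?thesis
    using that ideal unfolding semiring_prime_ideal_def by blast
qed

lemma nilpotent_free_power_nonzero:
  fixes a :: "'a::comm_semiring_1"
  assumes "nilpotent_free TYPE('a)" "a \<noteq> 0"
  shows "a ^ n \<noteq> 0"
proof (induction n rule: less_induct)
  case (less n)
  show ?case
  proof (cases "n \<le> 1")
    case True
    then show ?thesis using assms(2) by (cases n) auto
  next
    case False
    \<comment> \<open>Half of \<open>n\<close>, rounded up: since \<open>n\<close> is at least 2, it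
      is smaller than \<open>n\<close>, so induction applies; and \<open>2 * ?k \<ge> n\<close>, so
      the nonzero square of \<open>a ^ ?k\<close> is a multiple of \<open>a ^ n\<close>.\<close>
    let ?k = "(n + 1) div 2"
    have "a ^ ?k \<noteq> 0" using less False by simp
    then have "(a ^ ?k) ^ 2 \<noteq> 0"
      using assms(1) unfolding nilpotent_free_def by blast
    moreover have "(a ^ ?k) ^ 2 = a ^ n * a ^ (2 * ?k - n)"
      by (simp add: power_mult[symmetric] power_add[symmetric] mult.commute)
    ultimately show ?thesis by auto
  qed
qed

lemma coeff_products_mem_prime:
  fixes f g :: "'a::comm_semiring_1 fps"
  assumes prime: "semiring_prime_ideal P" and sub: "subtractive P" and "f * g = 0"
  shows "fps_nth f i * fps_nth g j \<in> P"
proof (rule ccontr)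
  have ideal: "semiring_ideal P"
    using prime by (simp add: semiring_prime_ideal_def)
  assume "fps_nth f i * fps_nth g j \<notin> P"
  then have ex: "fps_nth f i \<notin> P" "fps_nth g j \<notin> P"
    using semiring_ideal_mult[OF ideal] semiring_ideal_mult_right[OF ideal] by blast+
  define m where "m = (LEAST i. fps_nth f i \<notin> P)"
  define n where "n = (LEAST j. fps_nth g j \<notin> P)"
  have m: "fps_nth f m \<notin> P" "\<And>k. k < m \<Longrightarrow> fps_nth f k \<in> P"
    using LeastI[of "\<lambda>i. fps_nth f i \<notin> P", OF ex(1)] not_less_Least unfolding m_def by blast+
  have n: "fps_nth g n \<notin> P" "\<And>k. k < n \<Longrightarrow> fps_nth g k \<in> P"
    using LeastI[of "\<lambda>i. fps_nth g i \<notin> P", OF ex(2)] not_less_Least unfolding n_def by blast+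
  let ?h = "\<lambda>k. fps_nth f k * fps_nth g (m + n - k)"
  have "?h k \<in> P" if "k \<in> {0..m + n} - {m}" for k
  proof (cases "k < m")
    case True
    then show ?thesis using m(2) semiring_ideal_mult_right[OF ideal] by blast
  next
    case False
    \<comment> \<open>As \<open>k = m\<close> is excluded, \<open>m < k \<le> m + n\<close>; this
      forces \<open>n > 0\<close> and makes the truncated difference smaller than
      \<open>n\<close>.\<close>
    then have "m + n - k < n" using that by auto
    then show ?thesis using n(2) semiring_ideal_mult[OF ideal] by blast
  qed
  then have "sum ?h ({0..m + n} - {m}) \<in> P"
    by (rule semiring_ideal_sum[OF ideal])
  moreover have "sum ?h ({0..m + n} - {m}) + ?h m = fps_nth (f * g) (m + n)"
    using sum.remove[of "{0..m + n}" m ?h] by (simp add: fps_mult_nth add.commute)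
  then have "sum ?h ({0..m + n} - {m}) + ?h m \<in> P"
    using \<open>f * g = 0\<close> semiring_ideal_zero[OF ideal] by simp
  ultimately have "?h m \<in> P"
    using sub unfolding subtractive_def by blast
  then have "fps_nth f m * fps_nth g n \<in> P" by simp
  then show False
    using m(1) n(1) prime unfolding semiring_prime_ideal_def by blast
qed

text \<open>The summand at \<open>k\<close> and the sum of all the others add up to zero, so both
  vanish.\<close>

lemma zerosumfree_sum_eq_0:
  fixes h :: "'b \<Rightarrow> 'a::comm_semiring_1"
  assumes "zerosumfree TYPE('a)" "finite A" "sum h A = 0" "k \<in> A"
  shows "h k = 0"
proof -
  have "h k + sum h (A - {k}) = 0"
    using assms(2-4) by (simp add: sum.remove)
  then show ?thesis
    using assms(1) unfolding zerosumfree_def by blast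
qed

lemma zerosumfree_coeff_products:
  fixes f g :: "'a::comm_semiring_1 fps"
  assumes "zerosumfree TYPE('a)" "f * g = 0"
  shows "fps_nth f i * fps_nth g j = 0"
proof -
  have "(\<Sum>k=0..i + j. fps_nth f k * fps_nth g (i + j - k)) = 0"
    using assms(2) by (metis fps_mult_nth fps_zero_nth)
  from zerosumfree_sum_eq_0[OF assms(1) _ this, of i] show ?thesis by simp
qed

text \<open>A nonzero product would have only nonzero powers, so some prime ideal would miss it;
  that ideal is subtractive and hence contains the product after all.\<close>

lemma weak_Gaussian_coeff_products:
  fixes f g :: "'a::comm_semiring_1 fps"
  assumes "nilpotent_free TYPE('a)" "weak_Gaussian TYPE('a)" "f * g = 0"
  shows "fps_nth f i * fps_nth g j = 0"
proof (rule ccontr)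
  assume "fps_nth f i * fps_nth g j \<noteq> 0"
  then obtain P where "semiring_prime_ideal P" "fps_nth f i * fps_nth g j \<notin> P"
    using nilpotent_free_power_nonzero[OF assms(1)] prime_ideal_avoiding_powers by metis
  then show False
    using coeff_products_mem_prime assms(2,3) unfolding weak_Gaussian_def by blast
qed

text \<open>The annihilator of \<open>s\<close> is an ideal; once it contains the generators of
  \<open>coeff_ideal f\<close>, it contains the whole ideal.\<close>

lemma annihilator_coeff_ideal:
  assumes "\<And>i. s * fps_nth f i = 0"
  shows "(\<lambda>a. s * a) ` coeff_ideal f = {0}"
proof -
  have "semiring_ideal {a. s * a = 0}"
    by (rule semiring_idealI) (auto simp: distrib_left mult.left_commute)
  then have "coeff_ideal f \<subseteq> {a. s * a = 0}"
    using assms unfolding coeff_ideal_def ideal_generated_def by blast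
  \<comment> \<open>A member of the ideal is exhibited because the image has to equal
    \<open>{0}\<close> and must not be empty.\<close>
  moreover have "fps_nth f 0 \<in> coeff_ideal f"
    unfolding coeff_ideal_def ideal_generated_def by blast
  ultimately show ?thesis by auto
qed

theorem theorem4p9:
  assumes "(nilpotent_free TYPE('a::comm_semiring_1) \<and> weak_Gaussian TYPE('a)) \<or>
           zerosumfree TYPE('a)"
  shows "McCoy_fps TYPE('a)"
  unfolding McCoy_fps_def
proof (intro allI impI, elim conjE)
  fix f g :: "'a fps"
  assume "f * g = 0" "g \<noteq> 0"
  then have "fps_nth g j * fps_nth f i = 0" for i j
    using assms weak_Gaussian_coeff_products[of f g i j] zerosumfree_coeff_products[of f g i j]
    by (auto simp: mult.commute)
  moreover obtain j where "fps_nth g j \<noteq> 0"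
    using \<open>g \<noteq> 0\<close> by (auto simp: fps_eq_iff)
  ultimately show "\<exists>s. s \<noteq> 0 \<and> (\<lambda>a. s * a) ` coeff_ideal f = {0}"
    using annihilator_coeff_ideal by metis
qed

end
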